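(* Let $p_n(z;t_0,t_1,u_0,u_1)$ be the monic non-symmetric Wilson polynomials and let $\mathbf{B}_n(x;\mathfrak{a},\mathfrak{b},\mathfrak{c},\mathfrak{d})$ be the monic Bannai--Ito polynomials, each defined by its eigenvalue equation (given in the context). One has $$(-2)^{n}\,p_{n}\left(-\frac{x}{2}+\frac{1}{4};\ \frac{\mathfrak{c}+\mathfrak{d}}{2}+\frac{1}{4},\ \frac{\mathfrak{a}+\mathfrak{b}}{2}+\frac{1}{4},\ \frac{\mathfrak{c}-\mathfrak{d}}{2},\ \frac{\mathfrak{a}-\mathfrak{b}}{2}\right)=\mathbf{B}_{n}(x;\mathfrak{a},\mathfrak{b},\mathfrak{c},\mathfrak{d}),$$ where the parameters of $p_n$ are listed in the order $(t_0,t_1,u_0,u_1)$. Hence the non-symmetric Wilson polynomials coincide with the Bannai--Ito polynomials, up to an affine transformation.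
   Context: Operators. For a function $f$ of one variable $y$, set $R_yf(y)=f(-y)$, $T_y^{\pm}f(y)=f(y\pm1)$, and let $\mathbb{1}$ be the identity. Thus $T_y^{\pm}R_y f(y)=f(-y\mp 1)$. Bannai--Ito polynomials. These depend on four parameters $\mathfrak{a},\mathfrak{b},\mathfrak{c},\mathfrak{d}$. The monic polynomial $\mathbf{B}_n(x)=\mathbf{B}_n(x;\mathfrak{a},\mathfrak{b},\mathfrak{c},\mathfrak{d})$ of degree $n$ in $x$ is determined by the monicity condition and the eigenvalue equation $\mathcal{L}\mathbf{B}_n(x)=\lambda_n\mathbf{B}_n(x)$ with $\lambda_n=(-1)^n(n+\mathfrak{a}+\mathfrak{b}+\mathfrak{c}+\mathfrak{d}+3/2)$ and $$\mathcal{L}=\frac{(x+2\mathfrak{c}+1)(x+2\mathfrak{d}+1)}{2x+1}(T^{+}_{x}R_{x}-\mathbb{1})-\frac{(x-2\mathfrak{a}-1)(x-2\mathfrak{b}-1)}{2x-1}(T^{-}_{x}R_{x}-\mathbb{1})+(\mathfrak{a}+\mathfrak{b}+\mathfrak{c}+\mathfrak{d}+3/2)\mathbb{1}.$$ Non-symmetric Wilson polynomials. For complex parameters $t_0,t_1,u_0,u_1$, let $$T_0=\frac{(t_0+u_0-z+1/2)(t_0-u_0-z+1/2)}{1-2z}(T^{-}_{z}R_{z}-\mathbb{1})+t_0\mathbb{1},$$ $$T_1=\frac{(t_1+u_1+z)(t_1-u_1+z)}{2z}(R_{z}-\mathbb{1})+t_1\mathbb{1}.$$ Then $p_n(z)=p_n(z;t_0,t_1,u_0,u_1)$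 is defined as the unique monic polynomial of degree $n$ in $z$ satisfying $(T_0+T_1)p_n(z)=\gamma_np_n(z)$, where $\gamma_n=t_0+t_1+m$ if $n=2m$ and $\gamma_n=-(t_0+t_1+m)$ if $n=2m-1$. *)

theory Defs
  imports Complex_Main "HOL-Computational_Algebra.Polynomial"
begin

definition reflect :: "(complex \<Rightarrow> complex) \<Rightarrow> complex \<Rightarrow> complex" where
  "reflect f = (\<lambda>y. f (- y))"

definition shift_plus :: "(complex \<Rightarrow> complex) \<Rightarrow> complex \<Rightarrow> complex" where
  "shift_plus f = (\<lambda>y. f (y + 1))"

definition shift_minus :: "(complex \<Rightarrow> complex) \<Rightarrow> complex \<Rightarrow> complex" where
  "shift_minus f = (\<lambda>y. f (y - 1))"

(* The coefficients of the operators below are rational functions. At their poles the values are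
   artefacts of division by zero, so the eigenvalue equations are imposed only away from the poles;
   for polynomial eigenfunctions this is the identity of rational functions. *)

definition BI_operator ::
    "complex \<Rightarrow> complex \<Rightarrow> complex \<Rightarrow> complex \<Rightarrow> (complex \<Rightarrow> complex) \<Rightarrow> complex \<Rightarrow> complex" where
  "BI_operator a b c d f = (\<lambda>x.
      (x + 2 * c + 1) * (x + 2 * d + 1) / (2 * x + 1) * (shift_plus (reflect f) x - f x)
    - (x - 2 * a - 1) * (x - 2 * b - 1) / (2 * x - 1) * (shift_minus (reflect f) x - f x)
    + (a + b + c + d + 3 / 2) * f x)"

definition BI_eigenvalue :: "complex \<Rightarrow> complex \<Rightarrow> complex \<Rightarrow> complex \<Rightarrow> nat \<Rightarrow> complex" where
  "BI_eigenvalue a b c d n = (-1) ^ n * (of_nat n + a + b + c + d + 3 / 2)"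

definition is_Bannai_Ito ::
    "nat \<Rightarrow> complex \<Rightarrow> complex \<Rightarrow> complex \<Rightarrow> complex \<Rightarrow> complex poly \<Rightarrow> bool" where
  "is_Bannai_Ito n a b c d B \<longleftrightarrow>
     degree B = n \<and> lead_coeff B = 1 \<and>
     (\<forall>x. 2 * x + 1 \<noteq> 0 \<and> 2 * x - 1 \<noteq> 0 \<longrightarrow>
        BI_operator a b c d (poly B) x = BI_eigenvalue a b c d n * poly B x)"

(* Both eigenvalue problems are triangular with respect to the degree, so the monic eigenpolynomial
   of degree n exists and is unique exactly when the n-th eigenvalue differs from all the previous
   ones. The definite descriptions are meaningful only in that case. *)

definition Bannai_Ito ::
    "nat \<Rightarrow> complex \<Rightarrow> complex \<Rightarrow> complex \<Rightarrow> complex \<Rightarrow> complex poly" where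
  "Bannai_Ito n a b c d = (THE B. is_Bannai_Ito n a b c d B)"

definition NSW_T0 ::
    "complex \<Rightarrow> complex \<Rightarrow> (complex \<Rightarrow> complex) \<Rightarrow> complex \<Rightarrow> complex" where
  "NSW_T0 t0 u0 f = (\<lambda>z.
      (t0 + u0 - z + 1 / 2) * (t0 - u0 - z + 1 / 2) / (1 - 2 * z)
        * (shift_minus (reflect f) z - f z)
    + t0 * f z)"

definition NSW_T1 ::
    "complex \<Rightarrow> complex \<Rightarrow> (complex \<Rightarrow> complex) \<Rightarrow> complex \<Rightarrow> complex" where
  "NSW_T1 t1 u1 f = (\<lambda>z.
      (t1 + u1 + z) * (t1 - u1 + z) / (2 * z) * (reflect f z - f z)
    + t1 * f z)"

definition NSW_eigenvalue :: "complex \<Rightarrow> complex \<Rightarrow> nat \<Rightarrow> complex" where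
  "NSW_eigenvalue t0 t1 n =
     (if even n then t0 + t1 + of_nat (n div 2)
      else - (t0 + t1 + of_nat ((n + 1) div 2)))"

definition is_nonsymmetric_Wilson ::
    "nat \<Rightarrow> complex \<Rightarrow> complex \<Rightarrow> complex \<Rightarrow> complex \<Rightarrow> complex poly \<Rightarrow> bool" where
  "is_nonsymmetric_Wilson n t0 t1 u0 u1 p \<longleftrightarrow>
     degree p = n \<and> lead_coeff p = 1 \<and>
     (\<forall>z. 1 - 2 * z \<noteq> 0 \<and> 2 * z \<noteq> 0 \<longrightarrow>
        NSW_T0 t0 u0 (poly p) z + NSW_T1 t1 u1 (poly p) z
          = NSW_eigenvalue t0 t1 n * poly p z)"

definition nonsymmetric_Wilson ::
    "nat \<Rightarrow> complex \<Rightarrow> complex \<Rightarrow> complex \<Rightarrow> complex \<Rightarrow> complex poly" where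
  "nonsymmetric_Wilson n t0 t1 u0 u1 = (THE p. is_nonsymmetric_Wilson n t0 t1 u0 u1 p)"

end

theory Submission
  imports Defs
begin

text \<open>
  The affine map \<open>x = 1/2 - 2 z\<close> turns \<open>x \<mapsto> - x - 1\<close> into \<open>z \<mapsto> 1 - z\<close> and \<open>x \<mapsto> 1 - x\<close> into
  \<open>z \<mapsto> - z\<close>, and carries the Bannai--Ito operator to \<open>2 (T\<^sub>0 + T\<^sub>1) + 1/2\<close>; the eigenvalues
  match in the same way. The two defining descriptions therefore correspond, provided that they
  have a unique solution. This holds because \<open>T\<^sub>0 + T\<^sub>1\<close> maps \<open>e\<^sub>k\<close> to \<open>\<gamma>\<^sub>k e\<^sub>k\<close> plus a multiple
  of \<open>e\<^sub>k\<^sub>-\<^sub>1\<close> for the basis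
  \<open>e\<^sub>2\<^sub>m = \<Prod>j<m. (z\<^sup>2 - (\<alpha> + j)\<^sup>2)\<close>, \<open>e\<^sub>2\<^sub>m\<^sub>+\<^sub>1 = (z - \<alpha> - m) e\<^sub>2\<^sub>m\<close> with \<open>\<alpha> = t\<^sub>0 + u\<^sub>0 + 1/2\<close>:
  here \<open>e\<^sub>2\<^sub>m\<close> is even in \<open>z\<close>, and multiplied by the factor \<open>z - \<alpha>\<close> of the coefficient of \<open>T\<^sub>0\<close>,
  \<open>e\<^sub>k(1 - z)\<close> differs from \<open>e\<^sub>k(z)\<close> by few linear factors.
\<close>

section \<open>Triangular eigenvalue problems for polynomials\<close>

text \<open>An operator on polynomials that is only known through its graph, such as a difference
  operator with rational coefficients.\<close>

locale triangular_graph =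
  fixes R :: "'a::field poly \<Rightarrow> 'a poly \<Rightarrow> bool" and ev :: "nat \<Rightarrow> 'a"
  assumes add: "R p q \<Longrightarrow> R p' q' \<Longrightarrow> R (p + p') (q + q')"
    and smult: "R p q \<Longrightarrow> R (smult s p) (smult s q)"
    and functional: "R p q \<Longrightarrow> R p q' \<Longrightarrow> q = q'"
    and triangular: "\<exists>e v. (\<forall>i>k. coeff e i = 0) \<and> coeff e k = 1 \<and> (\<forall>i\<ge>k. coeff v i = 0)
          \<and> R e (Polynomial.smult (ev k) e + v)"
begin

lemma diff: "R p q \<Longrightarrow> R p' q' \<Longrightarrow> R (p - p') (q - q')"
  using add[of p q "Polynomial.smult (-1) p'" "Polynomial.smult (-1) q'"] smult[of p' q' "-1"]
  by simp

lemma zero: "R 0 0"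
  using triangular[of 0] smult[where s = 0] by fastforce

text \<open>Removing the multiple of \<open>e\<close> that cancels the coefficient at
  \<open>j\<close> lowers the bound, so by induction \<open>R\<close> is total and respects degree
  bounds. The uniqueness proof needs such an image for the remainder left after this
  removal.\<close>

lemma image_bounded:
  "(\<forall>i\<ge>j. coeff p i = 0) \<Longrightarrow> \<exists>q. R p q \<and> (\<forall>i\<ge>j. coeff q i = 0)"
proof (induction j arbitrary: p)
  case 0
  then have "p = 0" by (simp add: poly_eq_iff)
  then show ?case using zero by auto
next
  case (Suc j)
  obtain e v where e: "\<forall>i>j. coeff e i = 0" "coeff e j = 1" "\<forall>i\<ge>j. coeff v i = 0"
    "R e (Polynomial.smult (ev j) e + v)"
    using triangular by blast
  define c where "c = coeff p j"
  have "coeff (p - Polynomial.smult c e) i = 0" if "j \<le> i" for i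
    using that[unfolded le_eq_less_or_eq] Suc.prems e by (auto simp: c_def Suc_le_eq)
  then obtain q where q: "R (p - Polynomial.smult c e) q" "\<forall>i\<ge>j. coeff q i = 0"
    using Suc.IH by blast
  have "R p (q + Polynomial.smult c (Polynomial.smult (ev j) e + v))"
    using add[OF q(1) smult[OF e(4), of c]] by simp
  then show ?case using q(2) e by (force simp: Suc_le_eq)
qed

text \<open>Comparing coefficients at \<open>j\<close> in the eigenvalue equation gives
  \<open>(ev n - ev j) * c = 0\<close> for the top coefficient \<open>c\<close>, so the bound drops
  until nothing remains. The case \<open>j = n\<close> serves for the difference of two monic
  eigenvectors.\<close>

lemma eigenvector_unique:
  assumes "\<forall>m<n. ev m \<noteq> ev n"
  shows "j \<le> n \<Longrightarrow> (\<forall>i\<ge>j. coeff p i = 0) \<Longrightarrow> R p (Polynomial.smult (ev n) p) \<Longrightarrow> p = 0"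
proof (induction j)
  case 0
  then show ?case by (simp add: poly_eq_iff)
next
  case (Suc j)
  obtain e v where e: "\<forall>i>j. coeff e i = 0" "coeff e j = 1" "\<forall>i\<ge>j. coeff v i = 0"
    "R e (Polynomial.smult (ev j) e + v)"
    using triangular by blast
  define c where "c = coeff p j"
  have "coeff (p - Polynomial.smult c e) i = 0" if "j \<le> i" for i
    using that[unfolded le_eq_less_or_eq] Suc.prems e by (auto simp: c_def Suc_le_eq)
  then obtain q where q: "R (p - Polynomial.smult c e) q" "\<forall>i\<ge>j. coeff q i = 0"
    using image_bounded by blast
  have "q = Polynomial.smult (ev n) p - Polynomial.smult c (Polynomial.smult (ev j) e + v)"
    using functional[OF q(1) diff[OF Suc.prems(3) smult[OF e(4), of c]]] .
  then have "coeff q j = (ev n - ev j) * c"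
    using e by (simp add: c_def left_diff_distrib)
  moreover have "coeff q j = 0" "ev n - ev j \<noteq> 0"
    using q(2) assms Suc.prems(1) by (auto simp: Suc_le_eq)
  ultimately have "c = 0" by simp
  then have "coeff p i = 0" if "j \<le> i" for i
    using that[unfolded le_eq_less_or_eq] Suc.prems by (auto simp: c_def Suc_le_eq)
  then show ?case using Suc by simp
qed

text \<open>Back substitution for the equation (R - \<open>ev n\<close>) r = q below degree
  \<open>n\<close>: the diagonal entries \<open>ev j - ev n\<close> are nonzero, so the top
  coefficient of r can be solved for first.\<close>

lemma resolvent_exists:
  assumes "\<forall>m<n. ev m \<noteq> ev n"
  shows "j \<le> n \<Longrightarrow> (\<forall>i\<ge>j. coeff q i = 0) \<Longrightarrow>
    \<exists>r. (\<forall>i\<ge>j. coeff r i = 0) \<and> R r (q + Polynomial.smult (ev n) r)"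
proof (induction j arbitrary: q)
  case 0
  then have "q = 0" by (simp add: poly_eq_iff)
  then show ?case using zero by (intro exI[of _ 0]) simp
next
  case (Suc j)
  obtain e v where e: "\<forall>i>j. coeff e i = 0" "coeff e j = 1" "\<forall>i\<ge>j. coeff v i = 0"
    "R e (Polynomial.smult (ev j) e + v)"
    using triangular by blast
  have ne: "ev j \<noteq> ev n" using assms Suc.prems(1) by simp
  define c where "c = coeff q j / (ev j - ev n)"
  define r where "r = Polynomial.smult c e"
  define w where "w = Polynomial.smult c (Polynomial.smult (ev j) e + v)"
  \<comment> \<open>The right-hand side that remains once \<open>r\<close>, whose image is
    \<open>w\<close>, is accounted for; \<open>c\<close> was chosen so that its coefficient at
    \<open>j\<close> vanishes.\<close>
  define q' where "q' = q + Polynomial.smult (ev n) r - w"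
  have "coeff q' j = coeff q j - c * (ev j - ev n)"
    using e by (simp add: q'_def r_def w_def algebra_simps)
  then have "coeff q' j = 0" using ne by (simp add: c_def)
  then have "coeff q' i = 0" if "j \<le> i" for i
    using that[unfolded le_eq_less_or_eq] Suc.prems e by (auto simp: q'_def r_def w_def Suc_le_eq)
  then obtain r' where r': "\<forall>i\<ge>j. coeff r' i = 0" "R r' (q' + Polynomial.smult (ev n) r')"
    using Suc.IH Suc.prems(1) by fastforce
  have "R r w" using smult[OF e(4), of c] by (simp add: r_def w_def)
  from add[OF this r'(2)] have "R (r + r') (q + Polynomial.smult (ev n) (r + r'))"
    by (simp add: q'_def smult_add_right algebra_simps)
  moreover have "\<forall>i\<ge>Suc j. coeff (r + r') i = 0"
    using e r' by (simp add: r_def Suc_le_eq)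
  ultimately show ?case by blast
qed

lemma ex1_monic_eigenvector:
  assumes ev: "\<forall>m<n. ev m \<noteq> ev n"
  shows "\<exists>!p. degree p = n \<and> lead_coeff p = 1 \<and> R p (Polynomial.smult (ev n) p)"
proof (rule ex_ex1I)
  obtain e v where e: "\<forall>i>n. coeff e i = 0" "coeff e n = 1" "\<forall>i\<ge>n. coeff v i = 0"
    "R e (Polynomial.smult (ev n) e + v)"
    using triangular by blast
  \<comment> \<open>The correction \<open>r\<close> solves (R - \<open>ev n\<close>) r = -v, which
    turns \<open>e + r\<close> into an exact eigenvector and leaves the leading term alone.\<close>
  obtain r where r: "\<forall>i\<ge>n. coeff r i = 0" "R r (- v + Polynomial.smult (ev n) r)"
    using resolvent_exists[OF ev, of n "- v"] e(3) by auto
  have "R (e + r) (Polynomial.smult (ev n) (e + r))"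
    using add[OF e(4) r(2)] by (simp add: smult_add_right algebra_simps)
  moreover have "coeff (e + r) n = 1" using e r by simp
  moreover have "degree (e + r) = n"
    using calculation(2) e(1) r(1) by (intro antisym degree_le le_degree) auto
  ultimately show "\<exists>p. degree p = n \<and> lead_coeff p = 1 \<and> R p (Polynomial.smult (ev n) p)"
    by (intro exI[of _ "e + r"]) simp
next
  fix p p'
  assume p: "degree p = n \<and> lead_coeff p = 1 \<and> R p (Polynomial.smult (ev n) p)"
    and p': "degree p' = n \<and> lead_coeff p' = 1 \<and> R p' (Polynomial.smult (ev n) p')"
  have "R (p - p') (Polynomial.smult (ev n) (p - p'))"
    using p p' diff by (metis smult_diff_right)
  moreover have "\<forall>i\<ge>n. coeff (p - p') i = 0"
    using p p' by (auto simp: le_eq_less_or_eq coeff_eq_0)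
  ultimately have "p - p' = 0"
    using eigenvector_unique[OF ev order.refl] by blast
  then show "p = p'" by simp
qed

end

section \<open>The non-symmetric Wilson operator on its triangular basis\<close>

text \<open>A relation rather than a function: the values at the poles 0 and 1/2 are artefacts of
  division by zero, and that polynomials go to polynomials only becomes clear from the action on the
  basis.\<close>

definition NSW_graph ::
    "complex \<Rightarrow> complex \<Rightarrow> complex \<Rightarrow> complex \<Rightarrow> complex poly \<Rightarrow> complex poly \<Rightarrow> bool" where
  "NSW_graph t0 t1 u0 u1 p q \<longleftrightarrow>
     (\<forall>z. 1 - 2 * z \<noteq> 0 \<and> 2 * z \<noteq> 0 \<longrightarrow>
        NSW_T0 t0 u0 (poly p) z + NSW_T1 t1 u1 (poly p) z = poly q z)"

lemma is_nonsymmetric_Wilson_iff_graph: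
  "is_nonsymmetric_Wilson n t0 t1 u0 u1 p \<longleftrightarrow> degree p = n \<and> lead_coeff p = 1 \<and>
     NSW_graph t0 t1 u0 u1 p (smult (NSW_eigenvalue t0 t1 n) p)"
  by (simp add: is_nonsymmetric_Wilson_def NSW_graph_def)

text \<open>The basis element e_(2m); up to the sign (-1)^m it is the product of Pochhammer symbols
  (\<alpha> + z)_m (\<alpha> - z)_m.\<close>

fun NSW_square :: "complex \<Rightarrow> nat \<Rightarrow> complex poly" where
  "NSW_square \<alpha> 0 = 1"
| "NSW_square \<alpha> (Suc m) = [:- (\<alpha> + of_nat m)\<^sup>2, 0, 1:] * NSW_square \<alpha> m"

lemma degree_NSW_square: "degree (NSW_square \<alpha> m) = 2 * m"
  and monic_NSW_square: "lead_coeff (NSW_square \<alpha> m) = 1"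
proof (induction m)
  case (Suc m)
  {
    case 1
    have "NSW_square \<alpha> m \<noteq> 0" using Suc by auto
    then show ?case using Suc by (simp add: degree_mult_eq del: mult_pCons_left)
  next
    case 2
    show ?case using Suc by (simp add: lead_coeff_mult del: mult_pCons_left)
  }
qed simp_all

lemma NSW_square_even: "poly (NSW_square \<alpha> m) (- z) = poly (NSW_square \<alpha> m) z"
  by (induction m) (simp_all add: algebra_simps)

lemma poly_NSW_square_Suc:
  "poly (NSW_square \<alpha> (Suc m)) z
   = (z - \<alpha> - of_nat m) * (z + \<alpha> + of_nat m) * poly (NSW_square \<alpha> m) z"
  by (simp add: algebra_simps power2_eq_square)

text \<open>Under z -> 1 - z the factor with index j becomes (z + \<alpha> + j - 1)(z - \<alpha> - j
  - 1). Both strings of linear factors are shifted by one, so only their end factors differ;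
  cross-multiplication keeps this valid at every z.\<close>

lemma NSW_square_reflect:
  "(z - \<alpha>) * (z + \<alpha> + of_nat m - 1) * poly (NSW_square \<alpha> m) (1 - z)
   = (z + \<alpha> - 1) * (z - \<alpha> - of_nat m) * poly (NSW_square \<alpha> m) z"
proof (induction m)
  case (Suc m)
  define E where "E = poly (NSW_square \<alpha> m) (1 - z)"
  have "(z - \<alpha>) * (z + \<alpha> + of_nat (Suc m) - 1) * poly (NSW_square \<alpha> (Suc m)) (1 - z)
     = (z + \<alpha> + of_nat m) * (z - \<alpha> - of_nat m - 1) *
        ((z - \<alpha>) * (z + \<alpha> + of_nat m - 1) * E)"
    unfolding poly_NSW_square_Suc of_nat_Suc E_def by algebra
  also note Suc.IH[folded E_def]
  finally show ?case
    unfolding poly_NSW_square_Suc of_nat_Suc by algebra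
qed (simp add: algebra_simps)

text \<open>The last factor of the reflected product contributes z + \<alpha> + m - 1, exactly what
  the reflection identity at \<open>m\<close> consumes. The resulting factor 1 - 2z cancels the
  denominator of \<open>NSW_T0\<close>.\<close>

lemma NSW_square_reflect_diff:
  "(z - \<alpha>) * (poly (NSW_square \<alpha> (Suc m)) (1 - z) - poly (NSW_square \<alpha> (Suc m)) z)
   = (1 - 2 * z) * (of_nat (Suc m) * (z - \<alpha> - of_nat m) * poly (NSW_square \<alpha> m) z)"
proof -
  define E where "E = poly (NSW_square \<alpha> m) (1 - z)"
  have "(z - \<alpha>) * poly (NSW_square \<alpha> (Suc m)) (1 - z)
     = (z - \<alpha> - of_nat m - 1) * ((z - \<alpha>) * (z + \<alpha> + of_nat m - 1) * E)"
    unfolding poly_NSW_square_Suc E_def by algebra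
  also note NSW_square_reflect[of z \<alpha> m, folded E_def]
  finally show ?thesis
    unfolding right_diff_distrib poly_NSW_square_Suc of_nat_Suc by algebra
qed

text \<open>One numerator factor is absorbed into the difference to make it divisible by 1 - 2z; the
  other survives in front of the quotient \<open>g\<close>.\<close>

lemma NSW_T0_eqI:
  assumes "1 - 2 * z \<noteq> 0"
    and "(z - (t0 + u0 + 1 / 2)) * (f (1 - z) - f z) = (1 - 2 * z) * g"
  shows "NSW_T0 t0 u0 f z = (z - (t0 - u0 + 1 / 2)) * g + t0 * f z"
proof -
  have "(t0 + u0 - z + 1 / 2) * (t0 - u0 - z + 1 / 2) * (f (1 - z) - f z)
    = (z - (t0 - u0 + 1 / 2)) * ((z - (t0 + u0 + 1 / 2)) * (f (1 - z) - f z))"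
    by algebra
  then show ?thesis
    using assms by (simp add: NSW_T0_def shift_minus_def reflect_def)
qed

text \<open>\<open>NSW_T1\<close> acts as the scalar \<open>t1\<close> on an even polynomial. For
  \<open>NSW_T0\<close>, the splitting z - (t0 - u0 + 1/2) = (z + \<alpha> + m) - (2 t0 + 1 + m)
  separates the multiples of e_(2m+2) and e_(2m+1).\<close>

lemma NSW_graph_even:
  fixes t0 t1 u0 u1 :: complex
  defines "\<alpha> \<equiv> t0 + u0 + 1 / 2"
  shows "NSW_graph t0 t1 u0 u1 (NSW_square \<alpha> (Suc m))
     (smult (t0 + t1 + of_nat (Suc m)) (NSW_square \<alpha> (Suc m))
      + smult (- of_nat (Suc m) * (2 * t0 + 1 + of_nat m))
          ([:- \<alpha> - of_nat m, 1:] * NSW_square \<alpha> m))"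
  unfolding NSW_graph_def
proof (intro allI impI, elim conjE)
  fix z :: complex
  assume z: "1 - 2 * z \<noteq> 0" "2 * z \<noteq> 0"
  have T0: "NSW_T0 t0 u0 (poly (NSW_square \<alpha> (Suc m))) z
    = (z - (t0 - u0 + 1 / 2)) * (of_nat (Suc m) * (z - \<alpha> - of_nat m) * poly (NSW_square \<alpha> m) z)
      + t0 * poly (NSW_square \<alpha> (Suc m)) z"
    by (rule NSW_T0_eqI[OF z(1)]) (use NSW_square_reflect_diff[of z \<alpha> m] in \<open>simp add: \<alpha>_def\<close>)
  have T1: "NSW_T1 t1 u1 (poly (NSW_square \<alpha> (Suc m))) z = t1 * poly (NSW_square \<alpha> (Suc m)) z"
    by (simp only: NSW_T1_def reflect_def NSW_square_even) simp
  have \<beta>: "t0 - u0 + 1 / 2 = 2 * t0 + 1 - \<alpha>"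
    by (simp add: \<alpha>_def field_simps)
  show "NSW_T0 t0 u0 (poly (NSW_square \<alpha> (Suc m))) z + NSW_T1 t1 u1 (poly (NSW_square \<alpha> (Suc m))) z
    = poly (smult (t0 + t1 + of_nat (Suc m)) (NSW_square \<alpha> (Suc m))
      + smult (- of_nat (Suc m) * (2 * t0 + 1 + of_nat m))
          ([:- \<alpha> - of_nat m, 1:] * NSW_square \<alpha> m)) z"
    unfolding T0 T1 \<beta> by simp algebra
qed

text \<open>The image is e_(2m) times a polynomial in z whose quadratic terms, from
  \<open>NSW_T0\<close> and \<open>NSW_T1\<close>, cancel. The slope of the remaining linear factor
  is the eigenvalue, and its value at z = \<alpha> + m is the coefficient of e_(2m).\<close>

lemma NSW_graph_odd:
  fixes t0 t1 u0 u1 :: complex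
  defines "\<alpha> \<equiv> t0 + u0 + 1 / 2"
  shows "NSW_graph t0 t1 u0 u1 ([:- \<alpha> - of_nat m, 1:] * NSW_square \<alpha> m)
     (smult (- (t0 + t1 + of_nat (Suc m))) ([:- \<alpha> - of_nat m, 1:] * NSW_square \<alpha> m)
      + smult (- (\<alpha> + of_nat m + t1 + u1) * (\<alpha> + of_nat m + t1 - u1)) (NSW_square \<alpha> m))"
  unfolding NSW_graph_def
proof (intro allI impI, elim conjE)
  fix z :: complex
  assume z: "1 - 2 * z \<noteq> 0" "2 * z \<noteq> 0"
  let ?p = "[:- \<alpha> - of_nat m, 1:] * NSW_square \<alpha> m"
  define E E' where "E = poly (NSW_square \<alpha> m) z" and "E' = poly (NSW_square \<alpha> m) (1 - z)"
  have "(z - \<alpha>) * (z + \<alpha> + of_nat m - 1) * E' = (z + \<alpha> - 1) * (z - \<alpha> - of_nat m) * E"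
    unfolding E_def E'_def by (rule NSW_square_reflect)
  then have "(z - \<alpha>) * ((1 - z - \<alpha> - of_nat m) * E' - (z - \<alpha> - of_nat m) * E)
    = (1 - 2 * z) * ((z - \<alpha> - of_nat m) * E)"
    by algebra
  then have T0: "NSW_T0 t0 u0 (poly ?p) z
    = (z - (t0 - u0 + 1 / 2)) * ((z - \<alpha> - of_nat m) * E) + t0 * poly ?p z"
    by (intro NSW_T0_eqI[OF z(1)]) (simp add: \<alpha>_def E_def E'_def algebra_simps)
  have "reflect (poly ?p) z - poly ?p z = - (2 * z) * E"
    by (simp add: reflect_def NSW_square_even E_def algebra_simps)
  then have T1: "NSW_T1 t1 u1 (poly ?p) z
    = - ((t1 + u1 + z) * (t1 - u1 + z) * E) + t1 * poly ?p z"
    using z by (simp add: NSW_T1_def)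
  have \<beta>: "t0 - u0 + 1 / 2 = 2 * t0 + 1 - \<alpha>"
    by (simp add: \<alpha>_def field_simps)
  have p: "poly ?p z = (z - \<alpha> - of_nat m) * E"
    by (simp add: E_def algebra_simps)
  show "NSW_T0 t0 u0 (poly ?p) z + NSW_T1 t1 u1 (poly ?p) z
    = poly (smult (- (t0 + t1 + of_nat (Suc m))) ?p
      + smult (- (\<alpha> + of_nat m + t1 + u1) * (\<alpha> + of_nat m + t1 - u1)) (NSW_square \<alpha> m)) z"
    unfolding T0 T1 \<beta> poly_add poly_smult p E_def[symmetric] by simp algebra
qed

lemma NSW_graph_triangular:
  "\<exists>e v. (\<forall>i>k. coeff e i = 0) \<and> coeff e k = 1 \<and> (\<forall>i\<ge>k. coeff v i = 0)
     \<and> NSW_graph t0 t1 u0 u1 e (smult (NSW_eigenvalue t0 t1 k) e + v)"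
proof -
  define \<alpha> where "\<alpha> = t0 + u0 + 1 / 2"
  have odd: "degree ([:- \<alpha> - of_nat m, 1:] * NSW_square \<alpha> m) = Suc (2 * m)"
    "lead_coeff ([:- \<alpha> - of_nat m, 1:] * NSW_square \<alpha> m) = 1" for m
  proof -
    have "NSW_square \<alpha> m \<noteq> 0" using monic_NSW_square[of \<alpha> m] by auto
    then show "degree ([:- \<alpha> - of_nat m, 1:] * NSW_square \<alpha> m) = Suc (2 * m)"
      by (simp add: degree_mult_eq degree_NSW_square del: mult_pCons_left)
    show "lead_coeff ([:- \<alpha> - of_nat m, 1:] * NSW_square \<alpha> m) = 1"
      using monic_NSW_square[of \<alpha> m] by (simp add: lead_coeff_mult del: mult_pCons_left)
  qed
  \<comment> \<open>The constant e_0 is treated apart because no basis element lies below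
    it.\<close>
  consider "k = 0" | m where "k = 2 * Suc m" | m where "k = Suc (2 * m)"
    by (metis evenE oddE mult_0_right not0_implies_Suc Suc_eq_plus1)
  then show ?thesis
  proof cases
    case 1
    have "NSW_graph t0 t1 u0 u1 1 (smult (NSW_eigenvalue t0 t1 0) 1 + 0)"
      by (simp add: NSW_graph_def NSW_T0_def NSW_T1_def NSW_eigenvalue_def reflect_def
          shift_minus_def)
    then show ?thesis using 1 by (intro exI[of _ 1] exI[of _ 0]) simp
  next
    case 2
    have "NSW_eigenvalue t0 t1 k = t0 + t1 + of_nat (Suc m)"
      using 2 by (simp add: NSW_eigenvalue_def)
    with NSW_graph_even[of t0 t1 u0 u1 m, folded \<alpha>_def] show ?thesis
      using degree_NSW_square[of \<alpha> "Suc m"] monic_NSW_square[of \<alpha> "Suc m"] odd[of m] 2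
      by (intro exI[of _ "NSW_square \<alpha> (Suc m)"] exI conjI)
        (auto simp: coeff_eq_0 simp del: mult_pCons_left NSW_square.simps)
  next
    case 3
    have "NSW_eigenvalue t0 t1 k = - (t0 + t1 + of_nat (Suc m))"
      using 3 by (simp add: NSW_eigenvalue_def)
    with NSW_graph_odd[of t0 t1 u0 u1 m, folded \<alpha>_def] show ?thesis
      using degree_NSW_square[of \<alpha> m] monic_NSW_square[of \<alpha> m] odd[of m] 3
      by (intro exI[of _ "[:- \<alpha> - of_nat m, 1:] * NSW_square \<alpha> m"] exI conjI)
        (auto simp: coeff_eq_0 simp del: mult_pCons_left)
  qed
qed

section \<open>Existence and uniqueness of the non-symmetric Wilson polynomials\<close>

lemma poly_eqI_cofinite:
  fixes p q :: "'a::{idom,ring_char_0} poly"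
  assumes "finite A" and "\<And>z. z \<notin> A \<Longrightarrow> poly p z = poly q z"
  shows "p = q"
proof (rule ccontr)
  assume "p \<noteq> q"
  then have "finite {z. poly (p - q) z = 0}"
    by (intro poly_roots_finite) simp
  then have "finite (A \<union> {z. poly (p - q) z = 0})"
    using assms(1) by simp
  moreover have "A \<union> {z. poly (p - q) z = 0} = UNIV"
    using assms(2) by auto
  ultimately show False
    using infinite_UNIV_char_0 by metis
qed

lemma triangular_NSW_graph:
  "triangular_graph (NSW_graph t0 t1 u0 u1) (NSW_eigenvalue t0 t1)"
proof
  show "NSW_graph t0 t1 u0 u1 (p + p') (q + q')"
    if "NSW_graph t0 t1 u0 u1 p q" "NSW_graph t0 t1 u0 u1 p' q'" for p p' q q'
    unfolding NSW_graph_def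
  proof (intro allI impI)
    fix z :: complex
    assume z: "1 - 2 * z \<noteq> 0 \<and> 2 * z \<noteq> 0"
    have "NSW_T0 t0 u0 (poly (p + p')) z + NSW_T1 t1 u1 (poly (p + p')) z
      = (NSW_T0 t0 u0 (poly p) z + NSW_T1 t1 u1 (poly p) z)
        + (NSW_T0 t0 u0 (poly p') z + NSW_T1 t1 u1 (poly p') z)"
      unfolding NSW_T0_def NSW_T1_def reflect_def shift_minus_def poly_add by algebra
    then show "NSW_T0 t0 u0 (poly (p + p')) z + NSW_T1 t1 u1 (poly (p + p')) z
      = poly (q + q') z"
      using that z by (simp add: NSW_graph_def)
  qed
  show "NSW_graph t0 t1 u0 u1 (smult s p) (smult s q)"
    if "NSW_graph t0 t1 u0 u1 p q" for s p q
    unfolding NSW_graph_def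
  proof (intro allI impI)
    fix z :: complex
    assume z: "1 - 2 * z \<noteq> 0 \<and> 2 * z \<noteq> 0"
    have "NSW_T0 t0 u0 (poly (smult s p)) z + NSW_T1 t1 u1 (poly (smult s p)) z
      = s * (NSW_T0 t0 u0 (poly p) z + NSW_T1 t1 u1 (poly p) z)"
      unfolding NSW_T0_def NSW_T1_def reflect_def shift_minus_def poly_smult by algebra
    then show "NSW_T0 t0 u0 (poly (smult s p)) z + NSW_T1 t1 u1 (poly (smult s p)) z
      = poly (smult s q) z"
      using that z by (simp add: NSW_graph_def)
  qed
  show "q = q'" if "NSW_graph t0 t1 u0 u1 p q" "NSW_graph t0 t1 u0 u1 p q'" for p q q'
  \<comment> \<open>Two images of one polynomial agree off the poles, hence everywhere.\<close>
  proof (rule poly_eqI_cofinite[of "{1 / 2, 0}"])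
    fix z :: complex
    assume "z \<notin> {1 / 2, 0}"
    then have "1 - 2 * z \<noteq> 0 \<and> 2 * z \<noteq> 0" by (auto simp: field_simps)
    then show "poly q z = poly q' z"
      using that unfolding NSW_graph_def by metis
  qed simp
qed (rule NSW_graph_triangular)

lemma ex1_nonsymmetric_Wilson:
  assumes "\<forall>m<n. NSW_eigenvalue t0 t1 m \<noteq> NSW_eigenvalue t0 t1 n"
  shows "\<exists>!p. is_nonsymmetric_Wilson n t0 t1 u0 u1 p"
  unfolding is_nonsymmetric_Wilson_iff_graph
  using triangular_graph.ex1_monic_eigenvector[OF triangular_NSW_graph assms] .

section \<open>Transport of the eigenvalue problem along the affine map\<close>

text \<open>The relation is affine with nonzero slope, so distinctness of eigenvalues carries over
  between the two families.\<close>

lemma BI_eigenvalue_eq_NSW: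
  "BI_eigenvalue a b c d n
   = 2 * NSW_eigenvalue ((c + d) / 2 + 1 / 4) ((a + b) / 2 + 1 / 4) n + 1 / 2"
proof (cases "even n")
  case True
  then show ?thesis
    by (auto simp: BI_eigenvalue_def NSW_eigenvalue_def field_simps elim!: evenE)
next
  case False
  then show ?thesis
    by (auto simp: BI_eigenvalue_def NSW_eigenvalue_def field_simps elim!: oddE)
qed

text \<open>In each coefficient the numerator yields 4 and the denominator 2 or -2; the minus sign
  in front of the second term makes both contributions +2. The scalar term matches because a + b + c
  + d + 3/2 = 2 (t0 + t1) + 1/2.\<close>

lemma BI_operator_eq_NSW:
  assumes x: "2 * x + 1 \<noteq> 0" "2 * x - 1 \<noteq> 0"
    and f: "\<And>y. f y = s * g (- y / 2 + 1 / 4)"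
  shows "BI_operator a b c d f x
    = s * (2 * (NSW_T0 ((c + d) / 2 + 1 / 4) ((c - d) / 2) g (- x / 2 + 1 / 4)
         + NSW_T1 ((a + b) / 2 + 1 / 4) ((a - b) / 2) g (- x / 2 + 1 / 4))
      + 1 / 2 * g (- x / 2 + 1 / 4))"
proof -
  define z where "z = - x / 2 + 1 / 4"
  have xz: "x = 1 / 2 - 2 * z" by (simp add: z_def field_simps)
  have xz': "- (- (x + 1)) / 2 + 1 / 4 = 1 - z" "- (- (x - 1)) / 2 + 1 / 4 = - z"
    by (simp_all add: z_def field_simps)
  have fz: "f x = s * g z" "shift_plus (reflect f) x = s * g (1 - z)"
    "shift_minus (reflect f) x = s * g (- z)"
    unfolding shift_plus_def shift_minus_def reflect_def f xz' z_def[symmetric]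
    by (rule refl)+
  have gz: "shift_minus (reflect g) z = g (1 - z)" "reflect g z = g (- z)"
    by (simp_all add: shift_minus_def reflect_def)
  have nz: "1 - 2 * z \<noteq> 0" "z \<noteq> 0" using x by (auto simp: xz)
  have c0: "(x + 2 * c + 1) * (x + 2 * d + 1) / (2 * x + 1)
    = 2 * (((c + d) / 2 + 1 / 4 + (c - d) / 2 - z + 1 / 2)
        * ((c + d) / 2 + 1 / 4 - (c - d) / 2 - z + 1 / 2) / (1 - 2 * z))"
  proof -
    have "2 * x + 1 = 2 * (1 - 2 * z)" by (simp add: xz)
    moreover have "x + 2 * c + 1 = 2 * ((c + d) / 2 + 1 / 4 + (c - d) / 2 - z + 1 / 2)"
      "x + 2 * d + 1 = 2 * ((c + d) / 2 + 1 / 4 - (c - d) / 2 - z + 1 / 2)"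
      by (simp_all add: xz field_simps)
    moreover have "2 * r * (2 * s) / (2 * w) = 2 * (r * s / w)" for r s w :: complex
      by simp
    ultimately show ?thesis by metis
  qed
  have c1: "(x - 2 * a - 1) * (x - 2 * b - 1) / (2 * x - 1)
    = - 2 * (((a + b) / 2 + 1 / 4 + (a - b) / 2 + z)
        * ((a + b) / 2 + 1 / 4 - (a - b) / 2 + z) / (2 * z))"
  proof -
    have "2 * x - 1 = - 2 * (2 * z)" by (simp add: xz)
    moreover have "x - 2 * a - 1 = - 2 * ((a + b) / 2 + 1 / 4 + (a - b) / 2 + z)"
      "x - 2 * b - 1 = - 2 * ((a + b) / 2 + 1 / 4 - (a - b) / 2 + z)"
      by (simp_all add: xz field_simps)
    moreover have "- 2 * r * (- 2 * s) / (- 2 * w) = - 2 * (r * s / w)" for r s w :: complex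
      by simp
    ultimately show ?thesis by metis
  qed
  have "2 * K0 * (s * A - s * G) - - 2 * K1 * (s * B - s * G) + (a + b + c + d + 3 / 2) * (s * G)
    = s * (2 * (K0 * (A - G) + ((c + d) / 2 + 1 / 4) * G
         + (K1 * (B - G) + ((a + b) / 2 + 1 / 4) * G)) + 1 / 2 * G)" for K0 K1 A B G
    by (simp add: field_simps)
  then show ?thesis
    unfolding z_def[symmetric] BI_operator_def NSW_T0_def NSW_T1_def fz gz c0 c1 .
qed

text \<open>Composition with slope -1/2 multiplies the leading coefficient by (-1/2)^n, which (-2)^n
  undoes. In the eigenvalue equation the shifts by 1/2 cancel on both sides.\<close>

lemma is_Bannai_Ito_iff:
  "is_Bannai_Ito n a b c d (smult ((-2) ^ n) (pcompose p [:1 / 4, - 1 / 2:])) \<longleftrightarrow>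
   is_nonsymmetric_Wilson n ((c + d) / 2 + 1 / 4) ((a + b) / 2 + 1 / 4)
     ((c - d) / 2) ((a - b) / 2) p"
proof -
  define t0 t1 u0 u1 where t_defs: "t0 = (c + d) / 2 + 1 / 4" "t1 = (a + b) / 2 + 1 / 4"
    "u0 = (c - d) / 2" "u1 = (a - b) / 2"
  let ?B = "smult ((-2) ^ n) (pcompose p [:1 / 4, - 1 / 2:])"
  have deg: "degree ?B = degree p" by (simp add: degree_pcompose)
  have lead: "lead_coeff ?B = 1 \<longleftrightarrow> lead_coeff p = 1" if "degree p = n"
  proof -
    have "lead_coeff ?B = lead_coeff p * ((-2) ^ n * (- 1 / 2) ^ n)"
      using that by (simp add: lead_coeff_comp lead_coeff_smult)
    also have "(-2) ^ n * (- 1 / 2 :: complex) ^ n = 1"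
      by (simp flip: power_mult_distrib)
    finally show ?thesis by simp
  qed
  have polyB: "poly ?B y = (-2) ^ n * poly p (- y / 2 + 1 / 4)" for y
    by (simp add: poly_pcompose algebra_simps)
  have "BI_operator a b c d (poly ?B) x = BI_eigenvalue a b c d n * poly ?B x \<longleftrightarrow>
      NSW_T0 t0 u0 (poly p) (- x / 2 + 1 / 4) + NSW_T1 t1 u1 (poly p) (- x / 2 + 1 / 4)
      = NSW_eigenvalue t0 t1 n * poly p (- x / 2 + 1 / 4)"
    if "2 * x + 1 \<noteq> 0" "2 * x - 1 \<noteq> 0" for x
  proof -
    have "BI_operator a b c d (poly ?B) x = BI_eigenvalue a b c d n * poly ?B x \<longleftrightarrow>
        (-2) ^ n * (2 * (NSW_T0 t0 u0 (poly p) (- x / 2 + 1 / 4)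
           + NSW_T1 t1 u1 (poly p) (- x / 2 + 1 / 4)) + 1 / 2 * poly p (- x / 2 + 1 / 4))
        = (-2) ^ n * ((2 * NSW_eigenvalue t0 t1 n + 1 / 2) * poly p (- x / 2 + 1 / 4))"
      unfolding BI_operator_eq_NSW[where f = "poly ?B" and g = "poly p", OF that polyB] polyB BI_eigenvalue_eq_NSW t_defs
      by (simp only: mult.left_commute)
    moreover have "2 * A + 1 / 2 * P = (2 * l + 1 / 2) * P \<longleftrightarrow> A = l * P" for A P l :: complex
      by (simp add: distrib_right)
    ultimately show ?thesis
      by (simp only: mult_cancel_left) simp
  qed
  then have "(\<forall>x. 2 * x + 1 \<noteq> 0 \<and> 2 * x - 1 \<noteq> 0 \<longrightarrow>
        BI_operator a b c d (poly ?B) x = BI_eigenvalue a b c d n * poly ?B x) \<longleftrightarrow>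
     (\<forall>x. 2 * x + 1 \<noteq> 0 \<and> 2 * x - 1 \<noteq> 0 \<longrightarrow>
        NSW_T0 t0 u0 (poly p) (- x / 2 + 1 / 4) + NSW_T1 t1 u1 (poly p) (- x / 2 + 1 / 4)
      = NSW_eigenvalue t0 t1 n * poly p (- x / 2 + 1 / 4))"
    by blast
  \<comment> \<open>The affine map is a bijection that sends the poles x = -1/2 and x = 1/2 to z =
    1/2 and z = 0.\<close>
  also have "\<dots> \<longleftrightarrow> (\<forall>z. 1 - 2 * z \<noteq> 0 \<and> 2 * z \<noteq> 0 \<longrightarrow>
        NSW_T0 t0 u0 (poly p) z + NSW_T1 t1 u1 (poly p) z = NSW_eigenvalue t0 t1 n * poly p z)"
    (is "(\<forall>x. ?P x \<longrightarrow> ?Q (- x / 2 + 1 / 4)) \<longleftrightarrow> (\<forall>z. ?P' z \<longrightarrow> ?Q z)")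
  proof -
    have "1 - 2 * (- x / 2 + 1 / 4) = (2 * x + 1) / 2"
      "2 * (- x / 2 + 1 / 4) = - ((2 * x - 1) / 2)" for x :: complex
      by (simp_all add: field_simps)
    then have "?P x \<longleftrightarrow> ?P' (- x / 2 + 1 / 4)" for x
      by (simp only:) simp
    moreover have "- (1 / 2 - 2 * z) / 2 + 1 / 4 = z" for z :: complex
      by (simp add: field_simps)
    ultimately show ?thesis by metis
  qed
  finally show ?thesis
    unfolding is_Bannai_Ito_def is_nonsymmetric_Wilson_def t_defs[symmetric]
    using lead deg by metis
qed

section \<open>Identification of the two families\<close>

text \<open>Uniqueness on the Bannai--Ito side is inherited from the Wilson side, since the
  substitution is invertible on polynomials.\<close>

lemma Bannai_Ito_eq_nonsymmetric_Wilson: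
  assumes "\<forall>m<n. BI_eigenvalue a b c d m \<noteq> BI_eigenvalue a b c d n"
  shows "Bannai_Ito n a b c d = smult ((-2) ^ n) (pcompose
     (nonsymmetric_Wilson n ((c + d) / 2 + 1 / 4) ((a + b) / 2 + 1 / 4)
        ((c - d) / 2) ((a - b) / 2)) [:1 / 4, - 1 / 2:])"
proof -
  let ?is_W = "is_nonsymmetric_Wilson n ((c + d) / 2 + 1 / 4) ((a + b) / 2 + 1 / 4)
        ((c - d) / 2) ((a - b) / 2)"
  let ?\<Phi> = "\<lambda>p. smult ((-2) ^ n) (pcompose p [:1 / 4, - 1 / 2:]) :: complex poly"
  define W where "W = nonsymmetric_Wilson n ((c + d) / 2 + 1 / 4) ((a + b) / 2 + 1 / 4)
        ((c - d) / 2) ((a - b) / 2)"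
  have ex1: "\<exists>!p. ?is_W p"
    using assms by (intro ex1_nonsymmetric_Wilson) (simp add: BI_eigenvalue_eq_NSW)
  then have W: "?is_W W"
    unfolding W_def nonsymmetric_Wilson_def by (rule theI')
  have "Bannai_Ito n a b c d = ?\<Phi> W"
    unfolding Bannai_Ito_def
  proof (rule the_equality)
    show "is_Bannai_Ito n a b c d (?\<Phi> W)"
      using W by (simp only: is_Bannai_Ito_iff)
  next
    fix B
    assume B: "is_Bannai_Ito n a b c d B"
    \<comment> \<open>The preimage of \<open>B\<close>, obtained from the inverse substitution x =
      1/2 - 2z.\<close>
    define p where "p = smult ((- 1 / 2) ^ n) (pcompose B [:1 / 2, - 2:])"
    have "(-2) ^ n * (- 1 / 2 :: complex) ^ n = 1"
      by (simp flip: power_mult_distrib)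
    moreover have "- 2 * (- y / 2 + 1 / 4) + 1 / 2 = y" for y :: complex
      by (simp add: field_simps)
    ultimately have eq: "?\<Phi> p = B"
      by (intro poly_eqI_cofinite[of "{}"])
        (simp_all add: p_def poly_pcompose algebra_simps flip: mult.assoc)
    with B have "?is_W p" by (simp only: flip: is_Bannai_Ito_iff)
    with ex1 W have "p = W" by blast
    with eq show "B = ?\<Phi> W" by simp
  qed
  then show ?thesis by (simp only: W_def)
qed

text \<open>Distinctness from the earlier eigenvalues ensures that the definite descriptions denote
  the intended polynomials. The second conjunct makes the coincidence of the families precise: one
  choice of parameters and one affine map serve all degrees.\<close>

theorem proposition1:
  "(\<forall>(a::complex) b c d (n::nat) (x::complex).
      (\<forall>m<n. BI_eigenvalue a b c d m \<noteq> BI_eigenvalue a b c d n) \<longrightarrow>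
      (-2) ^ n * poly (nonsymmetric_Wilson n ((c + d) / 2 + 1 / 4) ((a + b) / 2 + 1 / 4)
                         ((c - d) / 2) ((a - b) / 2)) (- x / 2 + 1 / 4)
        = poly (Bannai_Ito n a b c d) x)
   \<and>
   (\<forall>(t0::complex) t1 u0 u1. \<exists>(a::complex) b c d (r::complex) (s::complex). r \<noteq> 0 \<and>
      (\<forall>n::nat. (\<forall>m<n. NSW_eigenvalue t0 t1 m \<noteq> NSW_eigenvalue t0 t1 n) \<longrightarrow>
         (\<forall>m<n. BI_eigenvalue a b c d m \<noteq> BI_eigenvalue a b c d n) \<and>
         (\<forall>z::complex. r ^ n * poly (nonsymmetric_Wilson n t0 t1 u0 u1) z
                         = poly (Bannai_Ito n a b c d) (r * z + s))))"
  (is "?explicit \<and> ?affine")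
proof
  show explicit: ?explicit
    by (simp add: Bannai_Ito_eq_nonsymmetric_Wilson poly_pcompose algebra_simps)
  show ?affine
  proof (intro allI)
    fix t0 t1 u0 u1 :: complex
    \<comment> \<open>The linear parameter map (a, b, c, d) -> (t0, t1, u0, u1), solved for a, b, c,
      d.\<close>
    define a b c d where abcd: "a = t1 + u1 - 1 / 4" "b = t1 - u1 - 1 / 4"
      "c = t0 + u0 - 1 / 4" "d = t0 - u0 - 1 / 4"
    have t: "(c + d) / 2 + 1 / 4 = t0" "(a + b) / 2 + 1 / 4 = t1"
      "(c - d) / 2 = u0" "(a - b) / 2 = u1"
      by (simp_all add: abcd field_simps)
    have ev: "BI_eigenvalue a b c d n = 2 * NSW_eigenvalue t0 t1 n + 1 / 2" for n
      using BI_eigenvalue_eq_NSW[of a b c d n] by (simp only: t)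
    \<comment> \<open>The scale -2 and offset 1/2 invert z = -x/2 + 1/4.\<close>
    have z: "- (- 2 * z + 1 / 2) / 2 + 1 / 4 = z" for z :: complex
      by (simp add: field_simps)
    have "(-2) ^ n * poly (nonsymmetric_Wilson n t0 t1 u0 u1) z
        = poly (Bannai_Ito n a b c d) (- 2 * z + 1 / 2)"
      if "\<forall>m<n. NSW_eigenvalue t0 t1 m \<noteq> NSW_eigenvalue t0 t1 n" for n z
    proof -
      have "\<forall>m<n. BI_eigenvalue a b c d m \<noteq> BI_eigenvalue a b c d n"
        using that by (simp add: ev)
      with explicit have "(-2) ^ n * poly (nonsymmetric_Wilson n ((c + d) / 2 + 1 / 4)
          ((a + b) / 2 + 1 / 4) ((c - d) / 2) ((a - b) / 2)) (- (- 2 * z + 1 / 2) / 2 + 1 / 4)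
        = poly (Bannai_Ito n a b c d) (- 2 * z + 1 / 2)"
        by blast
      then show ?thesis by (simp only: t z)
    qed
    then show "\<exists>a b c d r s. r \<noteq> 0 \<and>
      (\<forall>n::nat. (\<forall>m<n. NSW_eigenvalue t0 t1 m \<noteq> NSW_eigenvalue t0 t1 n) \<longrightarrow>
         (\<forall>m<n. BI_eigenvalue a b c d m \<noteq> BI_eigenvalue a b c d n) \<and>
         (\<forall>z::complex. r ^ n * poly (nonsymmetric_Wilson n t0 t1 u0 u1) z
                         = poly (Bannai_Ito n a b c d) (r * z + s)))"
      by (intro exI[of _ a] exI[of _ b] exI[of _ c] exI[of _ d] exI[of _ "-2"] exI[of _ "1 / 2"])
        (simp add: ev)
  qed
qed

end
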